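(* Let $m>n$ be non-negative integers. For every free continuous action of a compact group $G$ on the Menger compactum $\mu^n$ with $\dim(\mu^n/G)\le m$, one has $\dim\big((\mu^n*G)/G\big)\le m$, where the join $\mu^n*G$ carries the diagonal $G$-action.
   Context: $\mu^n$ denotes the universal $n$-dimensional Menger compactum, unique up to homeomorphism; concretely, it is the subset of the cube $[0,1]^{2n+1}$ obtained as the intersection of the following decreasing sequence: start with $[0,1]^{2n+1}$; at each step subdivide every remaining cube into $3^{2n+1}$ congruent subcubes and keep only those that meet the union of the $n$-dimensional faces of the cube being subdivided. Topological groups are Hausdorff. $\dim$ denotes covering dimension (equal to the inductive dimensions for separable metrizable spaces). For compact spaces $X,Y$, the topological join $X*Y$ is the quotient of $X\times Y\times[0,1]$ by the relation which, for each fixed $y_0\in Y$, identifies all points $(x,y_0,0)$ ($x\in X$), and, for each fixed $x_0\in X$, identifies all points $(x_0,y,1)$ ($y\in Y$). The diagonal action on $X*G$ is $[(x,h,t)]\cdot g=[(xg,hg,t)]$. *)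

theory Defs
  imports "HOL-Analysis.Analysis" "HOL-Algebra.Group"
begin

section \<open>Covering dimension\<close>

text \<open>
  \<open>covering_dim_le X m\<close> is \<open>dim X \<le> m\<close> for the covering dimension: every finite open cover
  has a finite open refinement of order at most \<open>m\<close>, that is, no point of \<open>X\<close> lies in more
  than \<open>m + 1\<close> members. It differs in general from the library's \<^const>\<open>dimension_le\<close>, which is the
  small inductive dimension.
\<close>

definition finite_open_cover :: "'a topology \<Rightarrow> 'a set set \<Rightarrow> bool" where
  "finite_open_cover X \<U> \<longleftrightarrow> finite \<U> \<and> (\<forall>U\<in>\<U>. openin X U) \<and> \<Union>\<U> = topspace X"

definition covering_dim_le :: "'a topology \<Rightarrow> nat \<Rightarrow> bool" where
  "covering_dim_le X m \<longleftrightarrow>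
     (\<forall>\<U>. finite_open_cover X \<U> \<longrightarrow>
        (\<exists>\<V>. finite_open_cover X \<V> \<and> (\<forall>V\<in>\<V>. \<exists>U\<in>\<U>. V \<subseteq> U) \<and>
             (\<forall>x\<in>topspace X. card {V \<in> \<V>. x \<in> V} \<le> m + 1)))"


section \<open>Quotient spaces\<close>

definition quotient_topology :: "'a topology \<Rightarrow> ('a \<times> 'a) set \<Rightarrow> 'a set topology" where
  "quotient_topology X r =
     topology (\<lambda>\<U>. \<U> \<subseteq> topspace X // r \<and> openin X {x \<in> topspace X. r `` {x} \<in> \<U>})"

lemma openin_quotient_topology:
  "openin (quotient_topology X r) \<U> \<longleftrightarrow>
     \<U> \<subseteq> topspace X // r \<and> openin X {x \<in> topspace X. r `` {x} \<in> \<U>}"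
proof -
  have "istopology (\<lambda>\<U>. \<U> \<subseteq> topspace X // r \<and> openin X {x \<in> topspace X. r `` {x} \<in> \<U>})"
    unfolding istopology_def
  proof (rule conjI; clarify)
    fix S T
    assume "S \<subseteq> topspace X // r" "openin X {x \<in> topspace X. r `` {x} \<in> S}"
      and "openin X {x \<in> topspace X. r `` {x} \<in> T}"
    moreover have "{x \<in> topspace X. r `` {x} \<in> S \<inter> T} =
        {x \<in> topspace X. r `` {x} \<in> S} \<inter> {x \<in> topspace X. r `` {x} \<in> T}"
      by blast
    ultimately show "S \<inter> T \<subseteq> topspace X // r \<and> openin X {x \<in> topspace X. r `` {x} \<in> S \<inter> T}"
      by auto
  next
    fix \<K>
    assume *: "\<forall>K\<in>\<K>. K \<subseteq> topspace X // r \<and> openin X {x \<in> topspace X. r `` {x} \<in> K}"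
    have "{x \<in> topspace X. r `` {x} \<in> \<Union>\<K>} = (\<Union>K\<in>\<K>. {x \<in> topspace X. r `` {x} \<in> K})"
      by blast
    moreover have "openin X (\<Union>K\<in>\<K>. {x \<in> topspace X. r `` {x} \<in> K})"
      using * by blast
    ultimately show "\<Union>\<K> \<subseteq> topspace X // r \<and> openin X {x \<in> topspace X. r `` {x} \<in> \<Union>\<K>}"
      using * by auto
  qed
  then show ?thesis
    by (simp add: quotient_topology_def)
qed

lemma topspace_quotient_topology [simp]: "topspace (quotient_topology X r) = topspace X // r"
proof -
  have "{x \<in> topspace X. r `` {x} \<in> topspace X // r} = topspace X"
    by (auto intro: quotientI)
  then have "openin (quotient_topology X r) (topspace X // r)"
    by (simp add: openin_quotient_topology)
  then show ?thesis
    by (metis openin_quotient_topology openin_subset openin_topspace subset_antisym)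
qed

lemma quotient_map_quotient_topology:
  "quotient_map X (quotient_topology X r) (\<lambda>x. r `` {x})"
  unfolding quotient_map_def
  by (auto simp: openin_quotient_topology quotient_def)


section \<open>Topological groups and their actions\<close>

locale topological_group = group G for G (structure) +
  fixes T :: "'a topology"
  assumes topspace_eq_carrier: "topspace T = carrier G"
    and Hausdorff: "Hausdorff_space T"
    and continuous_mult: "continuous_map (prod_topology T T) T (\<lambda>(g, h). g \<otimes> h)"
    and continuous_inv: "continuous_map T T (\<lambda>g. inv g)"

locale compact_topological_group = topological_group +
  assumes compact: "compact_space T"

locale continuous_right_action = topological_group G T for G (structure) and T +
  fixes X :: "'x topology" and act :: "'x \<Rightarrow> 'a \<Rightarrow> 'x"
  assumes act_one: "x \<in> topspace X \<Longrightarrow> act x \<one> = x"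
    and act_mult: "\<lbrakk>x \<in> topspace X; g \<in> carrier G; h \<in> carrier G\<rbrakk>
                     \<Longrightarrow> act (act x g) h = act x (g \<otimes> h)"
    and continuous_act: "continuous_map (prod_topology X T) X (\<lambda>(x, g). act x g)"

locale free_continuous_right_action = continuous_right_action +
  assumes free: "\<lbrakk>x \<in> topspace X; g \<in> carrier G; act x g = x\<rbrakk> \<Longrightarrow> g = \<one>"

definition orbit_rel :: "('g, 'b) monoid_scheme \<Rightarrow> 'x topology \<Rightarrow> ('x \<Rightarrow> 'g \<Rightarrow> 'x) \<Rightarrow> ('x \<times> 'x) set"
  where "orbit_rel G X act = {(x, act x g) | x g. x \<in> topspace X \<and> g \<in> carrier G}"

definition orbit_space :: "('g, 'b) monoid_scheme \<Rightarrow> 'x topology \<Rightarrow> ('x \<Rightarrow> 'g \<Rightarrow> 'x) \<Rightarrow> 'x set topology"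
  where "orbit_space G X act = quotient_topology X (orbit_rel G X act)"


section \<open>Joins\<close>

definition join_rel :: "'x topology \<Rightarrow> 'y topology \<Rightarrow> (('x \<times> 'y \<times> real) \<times> ('x \<times> 'y \<times> real)) set" where
  "join_rel X Y =
     {((x, y, t), (x', y', t')).
        x \<in> topspace X \<and> x' \<in> topspace X \<and> y \<in> topspace Y \<and> y' \<in> topspace Y \<and>
        t \<in> {0..1} \<and> t' = t \<and>
        (x' = x \<and> y' = y \<or> t = 0 \<and> y' = y \<or> t = 1 \<and> x' = x)}"

definition join_space :: "'x topology \<Rightarrow> 'y topology \<Rightarrow> ('x \<times> 'y \<times> real) set topology" where
  "join_space X Y =
     quotient_topology (prod_topology X (prod_topology Y (top_of_set {0..1}))) (join_rel X Y)"

lemma equiv_join_rel: "equiv (topspace X \<times> topspace Y \<times> {0..1}) (join_rel X Y)"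
  by (rule equivI) (auto simp: join_rel_def refl_on_def sym_def trans_def)

text \<open>
  The union below runs over all representatives of the class \<open>c\<close>; each of them contributes the
  same class (see \<open>diagonal_act_class\<close>).
\<close>

definition diagonal_act :: "('g, 'b) monoid_scheme \<Rightarrow> 'g topology \<Rightarrow> 'x topology \<Rightarrow> ('x \<Rightarrow> 'g \<Rightarrow> 'x)
    \<Rightarrow> ('x \<times> 'g \<times> real) set \<Rightarrow> 'g \<Rightarrow> ('x \<times> 'g \<times> real) set" where
  "diagonal_act G T X act c g = (\<Union>(x, h, t)\<in>c. join_rel X T `` {(act x g, h \<otimes>\<^bsub>G\<^esub> g, t)})"

lemma (in continuous_right_action) act_closed:
  assumes "x \<in> topspace X" "g \<in> carrier G"
  shows "act x g \<in> topspace X"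
proof -
  have "(x, g) \<in> topspace (prod_topology X T)"
    using assms by (simp add: topspace_eq_carrier)
  then show ?thesis
    using continuous_act by (force simp: continuous_map_def Pi_iff)
qed

lemma (in continuous_right_action) diagonal_act_class:
  assumes "x \<in> topspace X" "h \<in> carrier G" "t \<in> {0..1}" "g \<in> carrier G"
  shows "diagonal_act G T X act (join_rel X T `` {(x, h, t)}) g =
         join_rel X T `` {(act x g, h \<otimes> g, t)}"
proof -
  have eq: "join_rel X T `` {(act x' g, h' \<otimes> g, t')} = join_rel X T `` {(act x g, h \<otimes> g, t)}"
    if "((x, h, t), (x', h', t')) \<in> join_rel X T" for x' h' t'
  proof (rule equiv_class_eq[OF equiv_join_rel])
    show "((act x' g, h' \<otimes> g, t'), (act x g, h \<otimes> g, t)) \<in> join_rel X T"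
      using that assms by (auto simp: join_rel_def topspace_eq_carrier act_closed)
  qed
  have "((x, h, t), (x, h, t)) \<in> join_rel X T"
    using assms by (auto simp: join_rel_def topspace_eq_carrier)
  then show ?thesis
    unfolding diagonal_act_def using eq by fastforce
qed


section \<open>The Menger compactum\<close>

text \<open>
  Cubes in \<open>d\<close>-space are given by their minimal corner \<open>a\<close> and side length \<open>s\<close>. Points of
  \<open>d\<close>-space are functions \<open>nat \<Rightarrow> real\<close> vanishing at all indices \<open>\<ge> d\<close>, as in
  \<^const>\<open>Euclidean_space\<close>.
\<close>

definition cube :: "nat \<Rightarrow> (nat \<Rightarrow> real) \<Rightarrow> real \<Rightarrow> (nat \<Rightarrow> real) set" where
  "cube d a s = {x \<in> topspace (Euclidean_space d). \<forall>i<d. a i \<le> x i \<and> x i \<le> a i + s}"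

text \<open>
  An \<open>n\<close>-dimensional face leaves the coordinates in an \<open>n\<close>-element set \<open>F\<close> free and fixes each
  of the others at one of its two extreme values.
\<close>

definition cube_skeleton :: "nat \<Rightarrow> nat \<Rightarrow> (nat \<Rightarrow> real) \<Rightarrow> real \<Rightarrow> (nat \<Rightarrow> real) set" where
  "cube_skeleton n d a s =
     {x \<in> cube d a s. \<exists>F. F \<subseteq> {..<d} \<and> card F = n \<and> (\<forall>i\<in>{..<d} - F. x i = a i \<or> x i = a i + s)}"

definition subcube_corners :: "nat \<Rightarrow> (nat \<Rightarrow> real) \<Rightarrow> real \<Rightarrow> (nat \<Rightarrow> real) set" where
  "subcube_corners d a s =
     {b \<in> topspace (Euclidean_space d). \<forall>i<d. b i \<in> {a i, a i + s / 3, a i + 2 * s / 3}}"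

text \<open>
  \<open>menger_corners n k\<close> is the set of corners of the cubes, of side \<open>1 / 3 ^ k\<close>, that remain
  after \<open>k\<close> steps.
\<close>

primrec menger_corners :: "nat \<Rightarrow> nat \<Rightarrow> (nat \<Rightarrow> real) set" where
  "menger_corners n 0 = {\<lambda>i. 0}"
| "menger_corners n (Suc k) =
     (\<Union>a\<in>menger_corners n k.
        {b \<in> subcube_corners (2 * n + 1) a (1 / 3 ^ k).
           cube (2 * n + 1) b (1 / 3 ^ Suc k) \<inter> cube_skeleton n (2 * n + 1) a (1 / 3 ^ k) \<noteq> {}})"

definition menger_set :: "nat \<Rightarrow> (nat \<Rightarrow> real) set" where
  "menger_set n = (\<Inter>k. \<Union>a\<in>menger_corners n k. cube (2 * n + 1) a (1 / 3 ^ k))"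

definition menger_compactum :: "nat \<Rightarrow> (nat \<Rightarrow> real) topology" where
  "menger_compactum n = subtopology (Euclidean_space (2 * n + 1)) (menger_set n)"

end

theory Submission
  imports Defs
begin

text \<open>
  Every orbit of the diagonal action on \<open>X * G\<close> has a representative \<open>[x, 1, t]\<close>, so \<open>(X * G)/G\<close> is
  the quotient of \<open>X \<times> [0,1]\<close> that collapses \<open>X \<times> {0}\<close> to a point and \<open>X \<times> {1}\<close> to \<open>X/G\<close>: the
  mapping cone of \<open>X \<rightarrow> X/G\<close>. A finite cover of it by saturated open sets of \<open>X \<times> [0,1]\<close> is shrunk
  in three steps. Near \<open>t = 1\<close> the sets are cut down to the cylinders over a shrinking that comes from
  \<open>X/G\<close>, of order at most \<open>m\<close>; near \<open>t = 0\<close> all sets but one are discarded; on the remaining slab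
  \<open>X \<times> [a,b]\<close> nothing is identified, and a shrinking there extends because the slab is closed.

  For \<open>X = \<mu>\<^sup>n\<close> the slab has dimension at most \<open>n + 1 \<le> m\<close>: after scaling by \<open>3\<^sup>k\<close>, all but \<open>n\<close>
  coordinates of a point of \<open>\<mu>\<^sup>n\<close> are within \<open>1/3\<close> of an integer, so all but \<open>n + 1\<close> coordinates of a
  point of the slab are. Points with at most \<open>N\<close> coordinates far from the integers are
  covered by \<open>N + 1\<close> families of pairwise disjoint small open cells.
\<close>

section \<open>Covering dimension through shrinkings\<close>

text \<open>Each member of a refinement is assigned to one \<open>U i\<close> that contains it, and
  \<open>V i\<close> is the union of the members assigned to \<open>i\<close>. The indices whose set
  contains \<open>x\<close> are images of members containing \<open>x\<close>, so the order does not
  grow.\<close>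

lemma covering_dim_le_shrinking:
  assumes "covering_dim_le X m" "finite I" "\<And>i. i \<in> I \<Longrightarrow> openin X (U i)"
    and "topspace X \<subseteq> (\<Union>i\<in>I. U i)"
  obtains V where "\<And>i. i \<in> I \<Longrightarrow> openin X (V i)" "\<And>i. i \<in> I \<Longrightarrow> V i \<subseteq> U i"
    "topspace X \<subseteq> (\<Union>i\<in>I. V i)"
    "\<And>x. x \<in> topspace X \<Longrightarrow> card {i \<in> I. x \<in> V i} \<le> m + 1"
proof -
  have "(\<Union>i\<in>I. U i) \<subseteq> topspace X"
    using assms(3) openin_subset by fastforce
  then have "finite_open_cover X (U ` I)"
    unfolding finite_open_cover_def using assms by blast
  then obtain \<V> where \<V>: "finite_open_cover X \<V>" "\<And>V. V \<in> \<V> \<Longrightarrow> \<exists>i\<in>I. V \<subseteq> U i"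
    and ord: "\<And>x. x \<in> topspace X \<Longrightarrow> card {V \<in> \<V>. x \<in> V} \<le> m + 1"
    using assms(1) unfolding covering_dim_le_def by (auto 0 4)
  obtain f where f: "\<And>V. V \<in> \<V> \<Longrightarrow> f V \<in> I \<and> V \<subseteq> U (f V)"
    using \<V>(2) by metis
  define V' where "V' i = \<Union>{V \<in> \<V>. f V = i}" for i
  have "card {i \<in> I. x \<in> V' i} \<le> m + 1" if "x \<in> topspace X" for x
  proof -
    have "finite {V \<in> \<V>. x \<in> V}"
      using \<V>(1) by (simp add: finite_open_cover_def)
    moreover have "{i \<in> I. x \<in> V' i} \<subseteq> f ` {V \<in> \<V>. x \<in> V}"
      by (auto simp: V'_def)
    ultimately have "card {i \<in> I. x \<in> V' i} \<le> card {V \<in> \<V>. x \<in> V}"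
      by (meson card_image_le card_mono finite_imageI le_trans)
    then show ?thesis
      using ord[OF that] by linarith
  qed
  moreover have "openin X (V' i)" for i
    using \<V>(1) by (auto simp: V'_def finite_open_cover_def)
  moreover have "V' i \<subseteq> U i" for i
    using f by (auto simp: V'_def)
  moreover have "topspace X \<subseteq> (\<Union>i\<in>I. V' i)"
  proof
    fix x assume "x \<in> topspace X"
    then obtain V where "V \<in> \<V>" "x \<in> V"
      using \<V>(1) by (auto simp: finite_open_cover_def)
    then have "x \<in> V' (f V)"
      by (auto simp: V'_def)
    then show "x \<in> (\<Union>i\<in>I. V' i)"
      using f[OF \<open>V \<in> \<V>\<close>] by blast
  qed
  ultimately show ?thesis
    using that by blast
qed

lemma covering_dim_leI_shrinking:
  assumes "\<And>\<U>. finite_open_cover X \<U> \<Longrightarrow>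
     \<exists>V. (\<forall>U\<in>\<U>. openin X (V U) \<and> V U \<subseteq> U) \<and> topspace X \<subseteq> (\<Union>U\<in>\<U>. V U) \<and>
         (\<forall>x\<in>topspace X. card {U \<in> \<U>. x \<in> V U} \<le> m + 1)"
  shows "covering_dim_le X m"
  unfolding covering_dim_le_def
proof (intro allI impI)
  fix \<U> assume \<U>: "finite_open_cover X \<U>"
  then obtain V where V: "\<And>U. U \<in> \<U> \<Longrightarrow> openin X (V U) \<and> V U \<subseteq> U"
    "topspace X \<subseteq> (\<Union>U\<in>\<U>. V U)"
    and ord: "\<And>x. x \<in> topspace X \<Longrightarrow> card {U \<in> \<U>. x \<in> V U} \<le> m + 1"
    using assms[OF \<U>] by blast
  have fin: "finite \<U>"
    using \<U> by (simp add: finite_open_cover_def)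
  have "(\<Union>U\<in>\<U>. V U) \<subseteq> topspace X"
    using V(1) openin_subset by fastforce
  then have "finite_open_cover X (V ` \<U>)"
    unfolding finite_open_cover_def using V fin by blast
  moreover have "\<forall>W\<in>V ` \<U>. \<exists>U\<in>\<U>. W \<subseteq> U"
    using V by blast
  moreover have "card {W \<in> V ` \<U>. x \<in> W} \<le> m + 1" if "x \<in> topspace X" for x
  proof -
    have "{W \<in> V ` \<U>. x \<in> W} = V ` {U \<in> \<U>. x \<in> V U}"
      by blast
    then show ?thesis
      using ord[OF that] card_image_le[of "{U \<in> \<U>. x \<in> V U}" V] fin by simp
  qed
  ultimately show "\<exists>\<V>. finite_open_cover X \<V> \<and> (\<forall>V\<in>\<V>. \<exists>U\<in>\<U>. V \<subseteq> U) \<and>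
             (\<forall>x\<in>topspace X. card {V \<in> \<V>. x \<in> V} \<le> m + 1)"
    by blast
qed

lemma covering_dim_le_mono:
  assumes "covering_dim_le X n" "n \<le> m"
  shows "covering_dim_le X m"
proof (rule covering_dim_leI_shrinking)
  fix \<U> assume "finite_open_cover X \<U>"
  then have fin: "finite \<U>" and opn: "\<And>U. U \<in> \<U> \<Longrightarrow> openin X U"
    and cov: "topspace X \<subseteq> (\<Union>U\<in>\<U>. U)"
    by (auto simp: finite_open_cover_def)
  obtain V where "\<And>U. U \<in> \<U> \<Longrightarrow> openin X (V U)" "\<And>U. U \<in> \<U> \<Longrightarrow> V U \<subseteq> U"
    "topspace X \<subseteq> (\<Union>U\<in>\<U>. V U)"
    "\<And>x. x \<in> topspace X \<Longrightarrow> card {U \<in> \<U>. x \<in> V U} \<le> n + 1"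
    using covering_dim_le_shrinking[OF assms(1) fin opn cov] by blast
  then show "\<exists>V. (\<forall>U\<in>\<U>. openin X (V U) \<and> V U \<subseteq> U) \<and> topspace X \<subseteq> (\<Union>U\<in>\<U>. V U) \<and>
         (\<forall>x\<in>topspace X. card {U \<in> \<U>. x \<in> V U} \<le> m + 1)"
    using assms(2) by (intro exI[of _ V]) fastforce
qed


section \<open>The orbit space of the join\<close>

text \<open>Saturation makes \<open>W\<close> the full preimage of its image. Shrinkings built on
  the cylinder descend to the orbit space this way.\<close>

lemma quotient_map_openin_image:
  assumes "quotient_map X Y f" "openin X W"
    and sat: "\<And>x y. \<lbrakk>x \<in> W; y \<in> topspace X; f x = f y\<rbrakk> \<Longrightarrow> y \<in> W"
  shows "openin Y (f ` W)"
proof -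
  have W: "W \<subseteq> topspace X"
    using assms(2) by (rule openin_subset)
  then have "{x \<in> topspace X. f x \<in> f ` W} = W"
    using sat by auto
  moreover have "f ` W \<subseteq> topspace Y"
    using quotient_imp_surjective_map[OF assms(1)] W by blast
  ultimately show ?thesis
    using assms(1,2) unfolding quotient_map_def by metis
qed

text \<open>The tube lemma: the bad parameters form the projection of a closed set along a compact
  factor, and such a projection is a closed map.\<close>

lemma openin_all_slices:
  assumes "compact_space X" "openin (prod_topology X Y) W"
  shows "openin Y {t \<in> topspace Y. \<forall>x\<in>topspace X. (x, t) \<in> W}"
proof -
  have "closedin Y (snd ` (topspace (prod_topology X Y) - W))"
    using closed_map_snd[OF assms(1)] assms(2)
    by (metis closed_map_def closedin_def double_diff openin_subset order_refl Diff_subset)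
  moreover have "{t \<in> topspace Y. \<forall>x\<in>topspace X. (x, t) \<in> W} =
      topspace Y - snd ` (topspace (prod_topology X Y) - W)"
    by force
  ultimately show ?thesis
    by auto
qed

context continuous_right_action
begin

lemma orbit_class:
  assumes "x \<in> topspace X"
  shows "orbit_rel G X act `` {x} = act x ` carrier G"
  unfolding orbit_rel_def using assms by blast

lemma orbit_class_act:
  assumes "x \<in> topspace X" "g \<in> carrier G"
  shows "orbit_rel G X act `` {act x g} = orbit_rel G X act `` {x}"
proof -
  have "act (act x g) ` carrier G = (\<lambda>h. act x (g \<otimes> h)) ` carrier G"
    using assms by (intro image_cong) (auto simp: act_mult)
  also have "\<dots> = act x ` (\<otimes>) g ` carrier G"
    by (simp add: image_image)
  finally show ?thesis
    using assms by (simp add: orbit_class act_closed surj_const_mult)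
qed

lemma mem_orbit_class_self:
  assumes "x \<in> topspace X"
  shows "x \<in> orbit_rel G X act `` {x}"
  using act_one[OF assms] one_closed unfolding orbit_class[OF assms] by (metis imageI)

section \<open>The quotient map from the cylinder onto the orbit space of the join\<close>

definition join_orbit :: "'x \<times> 'a \<times> real \<Rightarrow> ('x \<times> 'a \<times> real) set set" where
  "join_orbit w = orbit_rel G (join_space X T) (diagonal_act G T X act) `` {join_rel X T `` {w}}"

lemma join_class_in_topspace:
  assumes "x \<in> topspace X" "h \<in> carrier G" "t \<in> {0..1}"
  shows "join_rel X T `` {(x, h, t)} \<in> topspace (join_space X T)"
  unfolding join_space_def topspace_quotient_topology
  using assms by (intro quotientI) (simp add: topspace_eq_carrier)

lemma join_orbit_eq:
  assumes "x \<in> topspace X" "h \<in> carrier G" "t \<in> {0..1}"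
  shows "join_orbit (x, h, t) = (\<lambda>g. join_rel X T `` {(act x g, h \<otimes> g, t)}) ` carrier G"
proof -
  have "join_orbit (x, h, t) = diagonal_act G T X act (join_rel X T `` {(x, h, t)}) ` carrier G"
    unfolding join_orbit_def orbit_rel_def using join_class_in_topspace[OF assms] by blast
  then show ?thesis
    using diagonal_act_class[OF assms] by simp
qed

text \<open>Left multiplication by \<open>k\<close> permutes the group, so both orbits run through
  the same join classes.\<close>

lemma join_orbit_translate:
  assumes "x \<in> topspace X" "h \<in> carrier G" "t \<in> {0..1}" "k \<in> carrier G"
  shows "join_orbit (act x k, h \<otimes> k, t) = join_orbit (x, h, t)"
proof -
  have *: "join_rel X T `` {(act (act x k) g, h \<otimes> k \<otimes> g, t)} =
      join_rel X T `` {(act x (k \<otimes> g), h \<otimes> (k \<otimes> g), t)}" if "g \<in> carrier G" for g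
    using that assms by (simp add: act_mult m_assoc)
  have "(\<otimes>) k ` carrier G = carrier G"
    using assms(4) by (rule surj_const_mult)
  then have "(\<lambda>g. join_rel X T `` {(act x g, h \<otimes> g, t)}) ` carrier G =
      (\<lambda>g. join_rel X T `` {(act x (k \<otimes> g), h \<otimes> (k \<otimes> g), t)}) ` carrier G"
    by (metis (no_types, lifting) image_cong image_image)
  then show ?thesis
    using assms * by (simp add: join_orbit_eq act_closed)
qed

abbreviation cyl :: "('x \<times> real) topology" where
  "cyl \<equiv> prod_topology X (top_of_set {0..1})"

definition cone_map :: "'x \<times> real \<Rightarrow> ('x \<times> 'a \<times> real) set set" where
  "cone_map z = join_orbit (fst z, \<one>, snd z)"

lemma join_orbit_eq_cone_map:
  assumes "x \<in> topspace X" "h \<in> carrier G" "t \<in> {0..1}"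
  shows "join_orbit (x, h, t) = cone_map (act x (inv h), t)"
  using join_orbit_translate[OF assms, of "inv h"] assms by (simp add: cone_map_def)

lemma cone_map_bottom:
  assumes "x \<in> topspace X" "y \<in> topspace X"
  shows "cone_map (x, 0) = cone_map (y, 0)"
proof -
  have "((x, \<one>, 0), (y, \<one>, 0)) \<in> join_rel X T"
    using assms by (auto simp: join_rel_def topspace_eq_carrier)
  then show ?thesis
    by (simp add: cone_map_def join_orbit_def equiv_class_eq[OF equiv_join_rel])
qed

text \<open>At \<open>t = 1\<close> the join forgets the group coordinate, so
  \<open>(act x g, \<one>, 1)\<close> and \<open>(act x g, g, 1)\<close> are the same join point;
  the latter is a translate of \<open>(x, \<one>, 1)\<close>.\<close>

lemma cone_map_top:
  assumes "x \<in> topspace X" "g \<in> carrier G"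
  shows "cone_map (act x g, 1) = cone_map (x, 1)"
proof -
  have "((act x g, \<one>, 1), (act x g, \<one> \<otimes> g, 1)) \<in> join_rel X T"
    using assms by (auto simp: join_rel_def topspace_eq_carrier act_closed)
  then have "join_orbit (act x g, \<one>, 1) = join_orbit (act x g, \<one> \<otimes> g, 1)"
    by (simp add: join_orbit_def equiv_class_eq[OF equiv_join_rel])
  then show ?thesis
    using join_orbit_translate[of x \<one> 1 g] assms by (simp add: cone_map_def)
qed

text \<open>The class of \<open>(y, \<one>, s)\<close> lies in the orbit of
  \<open>(x, \<one>, t)\<close>, hence is the class of some \<open>(act x g, g, t)\<close>. Off the
  top the group coordinates must agree, which forces \<open>g = \<one>\<close>; so the
  identifications at the two ends are the only ones.\<close>

lemma cone_map_eqD: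
  assumes "cone_map (x, t) = cone_map (y, s)" "x \<in> topspace X" "y \<in> topspace X"
    "t \<in> {0..1}" "s \<in> {0..1}"
  shows "s = t" "t = 0 \<or> y = x \<or> (t = 1 \<and> (\<exists>g\<in>carrier G. y = act x g))"
proof -
  \<comment> \<open>This exhibits the class as the member of its own orbit given by
    \<open>g = \<one>\<close>; \<open>l_one\<close> is disabled below to preserve that
    shape.\<close>
  have "join_rel X T `` {(y, \<one>, s)} = join_rel X T `` {(act y \<one>, \<one> \<otimes> \<one>, s)}"
    using act_one[OF assms(3)] by simp
  then have "join_rel X T `` {(y, \<one>, s)} \<in> cone_map (y, s)"
    using assms one_closed unfolding cone_map_def fst_conv snd_conv
    by (subst join_orbit_eq) (auto simp del: l_one)
  then obtain g where g: "g \<in> carrier G"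
    and "join_rel X T `` {(y, \<one>, s)} = join_rel X T `` {(act x g, g, t)}"
    unfolding assms(1)[symmetric] using join_orbit_eq[OF assms(2) one_closed assms(4)]
    by (auto simp: cone_map_def)
  then have "((y, \<one>, s), (act x g, g, t)) \<in> join_rel X T"
    using assms g act_closed
    by (intro eq_equiv_class[OF _ equiv_join_rel]) (auto simp: topspace_eq_carrier)
  then show "s = t" "t = 0 \<or> y = x \<or> (t = 1 \<and> (\<exists>g\<in>carrier G. y = act x g))"
    using g act_one[OF assms(2)] by (auto simp: join_rel_def)
qed

lemma quotient_map_join_orbit:
  "quotient_map (prod_topology X (prod_topology T (top_of_set {0..1})))
     (orbit_space G (join_space X T) (diagonal_act G T X act)) join_orbit"
proof -
  have "join_orbit = (\<lambda>c. orbit_rel G (join_space X T) (diagonal_act G T X act) `` {c}) \<circ>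
      (\<lambda>w. join_rel X T `` {w})"
    by (auto simp: join_orbit_def)
  moreover have "quotient_map (prod_topology X (prod_topology T (top_of_set {0..1})))
      (join_space X T) (\<lambda>w. join_rel X T `` {w})"
    unfolding join_space_def by (rule quotient_map_quotient_topology)
  ultimately show ?thesis
    unfolding orbit_space_def
    by (simp only: quotient_map_compose[OF _ quotient_map_quotient_topology])
qed

text \<open>A continuous map is a quotient map if its composite with some continuous map is one. The
  inner map \<open>?f\<close> moves a triple along its orbit until the group coordinate is
  \<open>\<one>\<close>, and the composite is \<open>join_orbit\<close>.\<close>

lemma quotient_map_cone_map:
  "quotient_map cyl (orbit_space G (join_space X T) (diagonal_act G T X act)) cone_map"
    (is "quotient_map _ ?Q _")
proof (rule quotient_map_from_composition)
  let ?W = "prod_topology X (prod_topology T (top_of_set {0..1::real}))"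
  let ?f = "\<lambda>w. (act (fst w) (inv (fst (snd w))), snd (snd w))"
  have X: "continuous_map ?W X fst" and T: "continuous_map ?W T (\<lambda>w. fst (snd w))"
    and t: "continuous_map ?W (top_of_set {0..1}) (\<lambda>w. snd (snd w))"
    using continuous_map_compose[OF continuous_map_snd continuous_map_fst]
      continuous_map_compose[OF continuous_map_snd continuous_map_snd]
    by (auto simp: comp_def continuous_map_fst)
  have "continuous_map ?W (prod_topology X T) (\<lambda>w. (fst w, inv (fst (snd w))))"
    using X continuous_map_compose[OF T continuous_inv]
    by (simp add: continuous_map_pairedI comp_def)
  from continuous_map_compose[OF this continuous_act]
  have "continuous_map ?W X (\<lambda>w. act (fst w) (inv (fst (snd w))))"
    by (simp add: comp_def)
  then show "continuous_map ?W cyl ?f"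
    using t by (rule continuous_map_pairedI)
  have "continuous_map cyl ?W (\<lambda>z. (fst z, \<one>, snd z))"
    by (intro continuous_map_pairedI continuous_map_fst continuous_map_snd)
       (simp add: topspace_eq_carrier)
  from continuous_map_compose[OF this quotient_imp_continuous_map[OF quotient_map_join_orbit]]
  show "continuous_map cyl ?Q cone_map"
    by (simp add: comp_def cone_map_def[abs_def])
  show "quotient_map ?W ?Q (cone_map \<circ> ?f)"
    by (rule quotient_map_eq[OF quotient_map_join_orbit])
       (auto simp: join_orbit_eq_cone_map topspace_eq_carrier)
qed

text \<open>The slab bound is required for all \<open>a\<close> and \<open>b\<close> because the two
  cut levels are found only after the cover is given; compactness of \<open>X\<close> makes them
  uniform in \<open>x\<close>.\<close>

theorem covering_dim_le_orbit_space_join: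
  assumes comp: "compact_space X"
    and orbit: "covering_dim_le (orbit_space G X act) m"
    and slab: "\<And>a b. covering_dim_le (prod_topology X (top_of_set {a..b::real})) m"
  shows "covering_dim_le (orbit_space G (join_space X T) (diagonal_act G T X act)) m"
    (is "covering_dim_le ?Q m")
\<comment> \<open>The set kept near the bottom is chosen through a point of \<open>X\<close>, so the
  empty space is treated apart.\<close>
proof (cases "topspace X = {}")
  case True
  then have "topspace ?Q = {}"
    using quotient_imp_surjective_map[OF quotient_map_cone_map] by auto
  then show ?thesis
    by (intro covering_dim_leI_shrinking) (auto intro!: exI[where x = "\<lambda>_. {}"])
next
  case False
  then obtain x0 where x0: "x0 \<in> topspace X"
    by blast
  let ?I = "top_of_set {0..1::real}"
  note cont = quotient_imp_continuous_map[OF quotient_map_cone_map]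
  have surj: "topspace ?Q = cone_map ` topspace cyl"
    using quotient_imp_surjective_map[OF quotient_map_cone_map] by simp
  have below: "openin cyl {z \<in> topspace cyl. snd z < c}" for c
  proof -
    have "openin ?I {t \<in> {0..1}. t < c}"
      using openin_open_Int[of "{..<c}" "{0..1::real}"] by (simp add: Int_def)
    from openin_continuous_map_preimage[OF continuous_map_snd this, of X]
    show ?thesis
      by (rule back_subst[of "openin _"]) (auto simp: mem_Times_iff)
  qed
  have above: "openin cyl {z \<in> topspace cyl. c < snd z}" for c
  proof -
    have "openin ?I {t \<in> {0..1}. c < t}"
      using openin_open_Int[of "{c<..}" "{0..1::real}"] by (simp add: Int_def)
    from openin_continuous_map_preimage[OF continuous_map_snd this, of X]
    show ?thesis
      by (rule back_subst[of "openin _"]) (auto simp: mem_Times_iff)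
  qed
  show ?thesis
  proof (rule covering_dim_leI_shrinking)
    fix \<U> assume \<U>: "finite_open_cover ?Q \<U>"
    then have fin: "finite \<U>" and opn: "\<And>U. U \<in> \<U> \<Longrightarrow> openin ?Q U" and cov: "\<Union>\<U> = topspace ?Q"
      by (auto simp: finite_open_cover_def)
    define u where "u U = {z \<in> topspace cyl. cone_map z \<in> U}" for U
    have u_open: "openin cyl (u U)" if "U \<in> \<U>" for U
      unfolding u_def using openin_continuous_map_preimage[OF cont opn[OF that]] .
    have u_cov: "\<exists>U\<in>\<U>. z \<in> u U" if "z \<in> topspace cyl" for z
      using that cov surj by (auto simp: u_def)

    \<comment> \<open>The traces \<open>w U\<close> on the top slice are invariant under
      \<open>G\<close>, so they descend to an open cover of \<open>X/G\<close>, where the dimension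
      hypothesis applies. The shrinking \<open>V\<close> found there is pulled back to
      \<open>v\<close>.\<close>
    define w where "w U = {x \<in> topspace X. (x, 1) \<in> u U}" for U
    have w_open: "openin X (w U)" if "U \<in> \<U>" for U
    proof -
      have "continuous_map X cyl (\<lambda>x. (x, 1))"
        by (simp add: continuous_map_pairedI)
      from openin_continuous_map_preimage[OF this u_open[OF that]]
      show ?thesis
        by (simp add: w_def)
    qed
    have w_act: "act x g \<in> w U \<longleftrightarrow> x \<in> w U" if "x \<in> topspace X" "g \<in> carrier G" for x g U
      using that by (auto simp: w_def u_def act_closed cone_map_top)
    let ?B = "orbit_space G X act"
    define \<pi> where "\<pi> x = orbit_rel G X act `` {x}" for x
    have \<pi>: "quotient_map X ?B \<pi>"
      unfolding \<pi>_def[abs_def] orbit_space_def by (rule quotient_map_quotient_topology)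
    have \<pi>D: "\<exists>g\<in>carrier G. y = act x g" if "\<pi> x = \<pi> y" "x \<in> topspace X" "y \<in> topspace X" for x y
      using that mem_orbit_class_self[of y] by (auto simp: \<pi>_def orbit_class)
    have \<pi>w: "x \<in> w U" if "x \<in> topspace X" "\<pi> x \<in> \<pi> ` w U" for x U
    proof -
      obtain y where "y \<in> w U" "\<pi> y = \<pi> x"
        using \<open>\<pi> x \<in> \<pi> ` w U\<close> by (metis imageE)
      moreover from this have "y \<in> topspace X"
        by (simp add: w_def)
      ultimately show ?thesis
        using that(1) \<pi>D w_act by metis
    qed
    have B_open: "openin ?B (\<pi> ` w U)" if "U \<in> \<U>" for U
      using \<pi>w by (intro quotient_map_openin_image[OF \<pi> w_open[OF that]]) (metis imageI)
    have B_cov: "topspace ?B \<subseteq> (\<Union>U\<in>\<U>. \<pi> ` w U)"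
    proof -
      have "\<exists>U\<in>\<U>. x \<in> w U" if "x \<in> topspace X" for x
        using u_cov[of "(x, 1)"] that by (auto simp: w_def)
      then show ?thesis
        unfolding quotient_imp_surjective_map[OF \<pi>, symmetric] by blast
    qed
    obtain V where V: "\<And>U. U \<in> \<U> \<Longrightarrow> openin ?B (V U)"
      "\<And>U. U \<in> \<U> \<Longrightarrow> V U \<subseteq> \<pi> ` w U" "topspace ?B \<subseteq> (\<Union>U\<in>\<U>. V U)"
      and V_ord: "\<And>y. y \<in> topspace ?B \<Longrightarrow> card {U \<in> \<U>. y \<in> V U} \<le> m + 1"
      using covering_dim_le_shrinking[OF orbit fin B_open B_cov] by blast
    define v where "v U = {x \<in> topspace X. \<pi> x \<in> V U}" for U
    have v_open: "openin X (v U)" if "U \<in> \<U>" for U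
      unfolding v_def
      using openin_continuous_map_preimage[OF quotient_imp_continuous_map[OF \<pi>] V(1)[OF that]] .
    have v_w: "v U \<subseteq> w U" if "U \<in> \<U>" for U
      using V(2)[OF that] \<pi>w by (auto simp: v_def)
    have \<pi>_top: "\<pi> x \<in> topspace ?B" if "x \<in> topspace X" for x
      using quotient_imp_surjective_map[OF \<pi>] that by blast
    have v_cov: "\<exists>U\<in>\<U>. x \<in> v U" if "x \<in> topspace X" for x
      using V(3) \<pi>_top[OF that] that by (auto simp: v_def)
    have v_ord: "card {U \<in> \<U>. x \<in> v U} \<le> m + 1" if "x \<in> topspace X" for x
      using V_ord[OF \<pi>_top[OF that]] that by (simp add: v_def)
    have v_act: "act x g \<in> v U \<longleftrightarrow> x \<in> v U" if "x \<in> topspace X" "g \<in> carrier G" for x g U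
      using that orbit_class_act[OF that] by (simp add: v_def \<pi>_def act_closed)

    define p where "p U = {z \<in> u U. fst z \<in> v U}" for U
    have p_open: "openin cyl (p U)" if "U \<in> \<U>" for U
    proof -
      have "p U = u U \<inter> {z \<in> topspace cyl. fst z \<in> v U}"
        by (auto simp: p_def u_def)
      then show ?thesis
        using openin_Int[OF u_open[OF that]
            openin_continuous_map_preimage[OF continuous_map_fst v_open[OF that], of ?I]]
        by simp
    qed
    \<comment> \<open>The sets \<open>p U\<close> cover the top slice, hence every slice close to
      it. The constant \<open>3/4\<close> here and \<open>1/4\<close> below only ensure
      \<open>a < 1/2 < b\<close>.\<close>
    obtain b where b: "1/2 < b" "b < 1"
      and b_cov: "\<And>x t. \<lbrakk>x \<in> topspace X; b \<le> t; t \<le> 1\<rbrakk> \<Longrightarrow> \<exists>U\<in>\<U>. (x, t) \<in> p U"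
    proof -
      let ?S = "{t \<in> topspace ?I. \<forall>x\<in>topspace X. (x, t) \<in> (\<Union>U\<in>\<U>. p U)}"
      have "openin ?I ?S"
        using p_open by (intro openin_all_slices[OF comp]) blast
      moreover have "1 \<in> ?S"
        using v_cov v_w by (fastforce simp: p_def w_def)
      ultimately obtain e where e: "e > 0" "\<And>t. t \<in> {0..1} \<Longrightarrow> dist t 1 < e \<Longrightarrow> t \<in> ?S"
        unfolding openin_euclidean_subtopology_iff by meson
      show ?thesis
      proof (rule that[of "max (3/4) (1 - e/2)"])
        fix x t assume "x \<in> topspace X" "max (3/4) (1 - e/2) \<le> t" "t \<le> (1::real)"
        then show "\<exists>U\<in>\<U>. (x, t) \<in> p U"
          using e(2)[of t] \<open>e > 0\<close> by (auto simp: dist_real_def)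
      qed (use \<open>e > 0\<close> in \<open>auto simp: max_def min_def\<close>)
    qed
    obtain U0 where U0: "U0 \<in> \<U>" "(x0, 0) \<in> u U0"
      using u_cov[of "(x0, 0)"] x0 by auto
    \<comment> \<open>The whole bottom slice is one point of the quotient, so the preimage
      \<open>u U0\<close> contains all of it once it contains \<open>(x0, 0)\<close>.\<close>
    have bottom: "(x, 0) \<in> u U0" if "x \<in> topspace X" for x
      using U0(2) cone_map_bottom[OF x0 that] that by (auto simp: u_def)
    obtain a where a: "0 < a" "a < 1/2"
      and a_cov: "\<And>x t. \<lbrakk>x \<in> topspace X; 0 \<le> t; t \<le> a\<rbrakk> \<Longrightarrow> (x, t) \<in> u U0"
    proof -
      let ?S = "{t \<in> topspace ?I. \<forall>x\<in>topspace X. (x, t) \<in> u U0}"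
      have "openin ?I ?S"
        using u_open[OF U0(1)] by (intro openin_all_slices[OF comp])
      moreover have "0 \<in> ?S"
        using bottom by auto
      ultimately obtain e where e: "e > 0" "\<And>t. t \<in> {0..1} \<Longrightarrow> dist t 0 < e \<Longrightarrow> t \<in> ?S"
        unfolding openin_euclidean_subtopology_iff by meson
      show ?thesis
      proof (rule that[of "min (1/4) (e/2)"])
        fix x t assume "x \<in> topspace X" "0 \<le> t" "t \<le> min (1/4) (e/2)"
        then show "(x, t) \<in> u U0"
          using e(2)[of t] \<open>e > 0\<close> by (auto simp: dist_real_def)
      qed (use \<open>e > 0\<close> in \<open>auto simp: max_def min_def\<close>)
    qed

    \<comment> \<open>Strict inequalities keep \<open>r U\<close> open. The slices from
      \<open>b\<close> upwards, \<open>b\<close> included, are still covered by the sets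
      \<open>p U\<close>, and those up to \<open>a\<close>, \<open>a\<close> included, by
      \<open>u U0\<close>.\<close>
    define r where "r U = {z \<in> u U. (snd z < b \<or> fst z \<in> v U) \<and> (U = U0 \<or> a < snd z)}" for U
    have r_open: "openin cyl (r U)" if "U \<in> \<U>" for U
    proof -
      have "r U = (u U \<inter> {z \<in> topspace cyl. snd z < b} \<union> p U) \<inter>
          (if U = U0 then topspace cyl else {z \<in> topspace cyl. a < snd z})"
        by (auto simp: r_def u_def p_def)
      then show ?thesis
        using u_open[OF that] p_open[OF that] below above openin_topspace[of cyl]
        by (auto intro!: openin_Int openin_Un simp del: openin_topspace)
    qed
    have r_cov: "\<exists>U\<in>\<U>. (x, t) \<in> r U" if "x \<in> topspace X" "t \<in> {0..1}" for x t
    proof -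
      consider "t \<le> a" | "a < t" "t < b" | "b \<le> t"
        by linarith
      then show ?thesis
      proof cases
        case 1
        then show ?thesis
          using a_cov[of x t] that a b U0(1) by (intro bexI[of _ U0]) (auto simp: r_def)
      next
        case 2
        then show ?thesis
          using u_cov[of "(x, t)"] that by (auto simp: r_def)
      next
        case 3
        then show ?thesis
          using b_cov[of x t] that a b by (auto simp: r_def p_def)
      qed
    qed
    let ?S = "prod_topology X (top_of_set {a..b})"
    have sub: "?S = subtopology cyl (topspace X \<times> {a..b})"
    proof -
      have "max 0 a = a" "min 1 b = b"
        using a b by auto
      then show ?thesis
        by (simp add: subtopology_Times subtopology_subtopology)
    qed
    have S_open: "openin ?S (r U \<inter> (topspace X \<times> {a..b}))" if "U \<in> \<U>" for U
      unfolding sub using r_open[OF that] by (auto simp: openin_subtopology)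
    have S_cov: "topspace ?S \<subseteq> (\<Union>U\<in>\<U>. r U \<inter> (topspace X \<times> {a..b}))"
    proof clarify
      fix x t assume "(x, t) \<in> topspace ?S"
      then show "(x, t) \<in> (\<Union>U\<in>\<U>. r U \<inter> (topspace X \<times> {a..b}))"
        using r_cov[of x t] a b by auto
    qed
    obtain s where s: "\<And>U. U \<in> \<U> \<Longrightarrow> openin ?S (s U)"
      "\<And>U. U \<in> \<U> \<Longrightarrow> s U \<subseteq> r U \<inter> (topspace X \<times> {a..b})" "topspace ?S \<subseteq> (\<Union>U\<in>\<U>. s U)"
      and s_ord: "\<And>z. z \<in> topspace ?S \<Longrightarrow> card {U \<in> \<U>. z \<in> s U} \<le> m + 1"
      using covering_dim_le_shrinking[OF slab fin S_open S_cov] by blast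
    \<comment> \<open>Membership in \<open>s U\<close> is demanded on the slab only. Its complement
      in the cylinder is open, so \<open>q U\<close> is open although \<open>s U\<close> is open
      merely relative to the slab.\<close>
    define q where "q U = {z \<in> r U. snd z \<in> {a..b} \<longrightarrow> z \<in> s U}" for U
    have q_open: "openin cyl (q U)" if U: "U \<in> \<U>" for U
    proof -
      obtain W where W: "openin cyl W" "s U = W \<inter> (topspace X \<times> {a..b})"
        using s(1)[OF U] unfolding sub openin_subtopology by blast
      have "q U = r U \<inter> (W \<union> {z \<in> topspace cyl. snd z < a} \<union> {z \<in> topspace cyl. b < snd z})"
        using s(2)[OF U] by (auto simp: q_def W(2) r_def u_def)
      then show ?thesis
        using W(1) r_open[OF U] below above by (auto intro!: openin_Int openin_Un)
    qed
    have q_cov: "\<exists>U\<in>\<U>. z \<in> q U" if "z \<in> topspace cyl" for z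
    proof (cases "snd z \<in> {a..b}")
      case True
      then have "z \<in> topspace ?S"
        using that by (auto simp: mem_Times_iff)
      then show ?thesis
        using s(2,3) by (fastforce simp: q_def)
    next
      case False
      then show ?thesis
        using r_cov[of "fst z" "snd z"] that by (auto simp: q_def mem_Times_iff)
    qed
    have q_ord: "card {U \<in> \<U>. z \<in> q U} \<le> m + 1" if "z \<in> topspace cyl" for z
    proof -
      \<comment> \<open>The order is bounded by \<open>1\<close> below the slab, by the order of
        \<open>s\<close> on it, and by the order of \<open>v\<close> above it.\<close>
      consider "snd z < a" | "snd z \<in> {a..b}" | "b < snd z"
        by force
      then show ?thesis
      proof cases
        case 1
        then have "{U \<in> \<U>. z \<in> q U} \<subseteq> {U0}"
          by (auto simp: q_def r_def)
        then have "card {U \<in> \<U>. z \<in> q U} \<le> card {U0}"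
          by (intro card_mono) auto
        then show ?thesis
          by simp
      next
        case 2
        then have "card {U \<in> \<U>. z \<in> q U} \<le> card {U \<in> \<U>. z \<in> s U}"
          using fin by (intro card_mono) (auto simp: q_def)
        also have "\<dots> \<le> m + 1"
          using that 2 by (intro s_ord) (auto simp: mem_Times_iff)
        finally show ?thesis .
      next
        case 3
        then have "card {U \<in> \<U>. z \<in> q U} \<le> card {U \<in> \<U>. fst z \<in> v U}"
          using fin by (intro card_mono) (auto simp: q_def r_def)
        also have "\<dots> \<le> m + 1"
          using that by (intro v_ord) (auto simp: mem_Times_iff)
        finally show ?thesis .
      qed
    qed
    have q_sat: "z' \<in> q U"
      if q: "z \<in> q U" and z': "z' \<in> topspace cyl" and eq: "cone_map z = cone_map z'" for z z' U
    proof -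
      obtain x t y t' where z: "z = (x, t)" "z' = (y, t')"
        by fastforce
      have top: "x \<in> topspace X" "y \<in> topspace X" "t \<in> {0..1}" "t' \<in> {0..1}"
        using q z' by (auto simp: z q_def r_def u_def)
      note D = cone_map_eqD[OF eq[unfolded z] top]
      have u: "z' \<in> u U"
        using q z' eq by (auto simp: q_def r_def u_def)
      \<comment> \<open>Distinct points are identified only at the ends. At the bottom only
        \<open>q U0\<close> is nonempty and it holds the whole slice; at the top \<open>q U\<close>
        is cut out by the invariant set \<open>v U\<close>.\<close>
      consider "t = 0" | "y = x" | g where "t = 1" "g \<in> carrier G" "y = act x g"
        using D(2) by blast
      then show ?thesis
        using q u a b top D(1) by cases (auto simp: z q_def r_def v_act)
    qed
    show "\<exists>V. (\<forall>U\<in>\<U>. openin ?Q (V U) \<and> V U \<subseteq> U) \<and> topspace ?Q \<subseteq> (\<Union>U\<in>\<U>. V U) \<and>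
         (\<forall>x\<in>topspace ?Q. card {U \<in> \<U>. x \<in> V U} \<le> m + 1)"
    proof (intro exI conjI ballI)
      fix U assume U: "U \<in> \<U>"
      show "openin ?Q (cone_map ` q U)"
        using quotient_map_cone_map q_open[OF U] q_sat by (rule quotient_map_openin_image)
      show "cone_map ` q U \<subseteq> U"
        by (auto simp: q_def r_def u_def)
    next
      show "topspace ?Q \<subseteq> (\<Union>U\<in>\<U>. cone_map ` q U)"
        unfolding surj using q_cov by blast
    next
      fix y assume "y \<in> topspace ?Q"
      then obtain z where z: "z \<in> topspace cyl" "y = cone_map z"
        unfolding surj by blast
      \<comment> \<open>Saturation makes the count at \<open>y\<close> independent of the chosen
        preimage \<open>z\<close>.\<close>
      have "{U \<in> \<U>. y \<in> cone_map ` q U} = {U \<in> \<U>. z \<in> q U}"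
        using z q_sat by auto
      then show "card {U \<in> \<U>. y \<in> cone_map ` q U} \<le> m + 1"
        using q_ord[OF z(1)] by simp
    qed
  qed
qed

end


section \<open>The dimension of a slab over the Menger compactum\<close>

text \<open>
  The levels lie strictly between \<open>1/3\<close> and \<open>1/2\<close> and decrease. In a cell of family \<open>j\<close> the coordinates
  in \<open>F\<close> are farther than \<open>level j\<close> from the integers and the others are closer. A point lies in a cell
  of family \<open>j\<close> for the least \<open>j\<close> such that at most \<open>j\<close> coordinates have distance at least \<open>level j\<close>:
  by minimality at least \<open>j\<close> of them have distance at least \<open>level (j - 1) > level j\<close>, so no
  coordinate has distance exactly \<open>level j\<close>.
\<close>

definition level :: "nat \<Rightarrow> real" where
  "level j = 1/3 + 1 / (6 * (real j + 2))"

lemma level_bounds: "1/3 < level j" "level j < 1/2"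
  by (auto simp: level_def field_simps)

lemma level_decreasing: "level (Suc j) < level j"
  by (simp add: level_def field_simps)

definition cell :: "nat \<Rightarrow> nat \<Rightarrow> nat set \<Rightarrow> (nat \<Rightarrow> int) \<Rightarrow> (nat \<Rightarrow> real) set" where
  "cell d j F z =
     {y. \<forall>i\<le>d. if i \<in> F then z i + level j < y i \<and> y i < real_of_int (z i) + 1 - level j
               else \<bar>y i - z i\<bar> < level j}"

text \<open>A coordinate of \<open>y\<close> tells by its distance to the integers whether its index
  is in \<open>F\<close>, and then \<open>z i\<close> is its floor or its nearest integer, as
  \<open>level j\<close> is positive and below \<open>1/2\<close>. Only the cells agree:
  \<open>F\<close> and \<open>z\<close> are arbitrary beyond \<open>d\<close>.\<close>

lemma cell_eq_of_common_point:
  assumes "y \<in> cell d j F z" "y \<in> cell d j F' z'"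
  shows "cell d j F z = cell d j F' z'"
proof -
  have "(i \<in> F \<longleftrightarrow> i \<in> F') \<and> z i = z' i" if "i \<le> d" for i
  proof -
    have y: "if i \<in> F then z i + level j < y i \<and> y i < real_of_int (z i) + 1 - level j
        else \<bar>y i - z i\<bar> < level j"
      and y': "if i \<in> F' then z' i + level j < y i \<and> y i < real_of_int (z' i) + 1 - level j
        else \<bar>y i - z' i\<bar> < level j"
      using assms that by (auto simp: cell_def)
    note lev = level_bounds[of j]
    consider "i \<in> F" "i \<in> F'" | "i \<in> F" "i \<notin> F'" | "i \<notin> F" "i \<in> F'" | "i \<notin> F" "i \<notin> F'"
      by blast
    then show ?thesis
    proof cases
      case 2
      then have "real_of_int (z i) < z' i" "z' i < real_of_int (z i) + 1"
        using y y' lev by (auto simp: abs_less_iff)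
      then have False
        by (metis of_int_1 of_int_add of_int_less_iff zless_add1_eq not_less_iff_gr_or_eq)
      then show ?thesis ..
    next
      case 3
      then have "real_of_int (z' i) < z i" "z i < real_of_int (z' i) + 1"
        using y y' lev by (auto simp: abs_less_iff)
      then have False
        by (metis of_int_1 of_int_add of_int_less_iff zless_add1_eq not_less_iff_gr_or_eq)
      then show ?thesis ..
    qed (use y y' lev in \<open>auto simp: abs_less_iff\<close>)
  qed
  then show ?thesis
    by (auto simp: cell_def)
qed

text \<open>The two kinds of coordinate range over open intervals of length
  \<open>1 - 2 * level j\<close> and \<open>2 * level j\<close>, both less than
  \<open>1\<close>.\<close>

lemma cell_diameter:
  assumes "y \<in> cell d j F z" "y' \<in> cell d j F z" "i \<le> d"
  shows "\<bar>y i - y' i\<bar> < 1"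
  using assms level_bounds[of j] by (auto simp: cell_def split: if_splits dest!: spec[of _ i])

lemma cell_cover:
  fixes y :: "nat \<Rightarrow> real"
  assumes D: "card D \<le> N" "finite D"
    and near: "\<And>i. i \<le> d \<Longrightarrow> i \<notin> D \<Longrightarrow> \<exists>k::int. \<bar>y i - k\<bar> \<le> 1/3"
  obtains j F z where "j \<le> N" "y \<in> cell d j F z"
proof -
  define \<delta> where "\<delta> i = \<bar>y i - round (y i)\<bar>" for i
  have \<delta>: "\<delta> i \<le> \<bar>y i - of_int k\<bar>" for i k
    unfolding \<delta>_def by (rule round_diff_minimal)
  define E where "E j = {i. i \<le> d \<and> level j \<le> \<delta> i}" for j
  have fin: "finite (E j)" for j
    by (simp add: E_def)
  \<comment> \<open>Coordinates outside \<open>D\<close> are within \<open>1/3\<close> of an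
    integer, and every level exceeds \<open>1/3\<close>. So \<open>j = N\<close> qualifies and a
    least \<open>j\<close> exists.\<close>
  have "E N \<subseteq> D"
  proof
    fix i assume i: "i \<in> E N"
    show "i \<in> D"
    proof (rule ccontr)
      assume "i \<notin> D"
      then obtain k :: int where "\<bar>y i - k\<bar> \<le> 1/3"
        using near[of i] i by (auto simp: E_def)
      then show False
        using \<delta>[of i k] i level_bounds[of N] by (simp add: E_def)
    qed
  qed
  then have "card (E N) \<le> N"
    using D card_mono le_trans by blast
  then obtain j where j: "card (E j) \<le> j" "j \<le> N" and least: "\<And>k. k < j \<Longrightarrow> \<not> card (E k) \<le> k"
    using exists_least_iff[of "\<lambda>j. card (E j) \<le> j"] by (metis not_le)
  have strict: "level j < \<delta> i" if "i \<in> E j" for i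
  proof (cases j)
    case 0
    then show ?thesis
      using j that fin by (simp add: card_eq_0_iff)
  next
    case (Suc k)
    have sub: "E k \<subseteq> E j"
      using level_decreasing[of k] by (auto simp: E_def Suc)
    moreover have "card (E j) \<le> card (E k)"
      using least[of k] j by (simp add: Suc)
    ultimately have "E k = E j"
      using fin by (meson card_seteq)
    then have "level k \<le> \<delta> i"
      using that unfolding E_def by blast
    then show ?thesis
      using level_decreasing[of k] by (simp add: Suc)
  qed
  \<comment> \<open>A far coordinate lies in the gap that starts at its floor; a near one belongs to
    its nearest integer.\<close>
  define z where "z i = (if i \<in> E j then \<lfloor>y i\<rfloor> else round (y i))" for i
  have "y \<in> cell d j (E j) z"
    unfolding cell_def
  proof (intro CollectI allI impI)
    fix i assume "i \<le> d"
    show "if i \<in> E j then z i + level j < y i \<and> y i < real_of_int (z i) + 1 - level j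
               else \<bar>y i - z i\<bar> < level j"
    proof (cases "i \<in> E j")
      case True
      have "\<delta> i \<le> \<bar>y i - \<lfloor>y i\<rfloor>\<bar>" "\<delta> i \<le> \<bar>y i - (\<lfloor>y i\<rfloor> + 1)\<bar>"
        using \<delta>[of i "\<lfloor>y i\<rfloor>"] \<delta>[of i "\<lfloor>y i\<rfloor> + 1"] by auto
      then show ?thesis
        using True strict[OF True] by (auto simp: z_def)
    next
      case False
      then show ?thesis
        using \<open>i \<le> d\<close> by (auto simp: E_def z_def \<delta>_def)
    qed
  qed
  then show ?thesis
    using that j by blast
qed

section \<open>Points of the Menger set near the scaled integer grid\<close>

lemma menger_corners_grid:
  assumes "a \<in> menger_corners n k" "i < 2 * n + 1"
  shows "3 ^ k * a i \<in> \<int>"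
  using assms(1)
proof (induction k arbitrary: a)
  case 0
  then show ?case
    by simp
next
  case (Suc k)
  then obtain c where c: "c \<in> menger_corners n k" "a \<in> subcube_corners (2 * n + 1) c (1 / 3 ^ k)"
    by auto
  then have "a i \<in> {c i, c i + 1 / 3 ^ k / 3, c i + 2 * (1 / 3 ^ k) / 3}"
    using assms(2) by (auto simp: subcube_corners_def)
  then have "3 ^ Suc k * a i \<in> {3 * (3 ^ k * c i), 3 * (3 ^ k * c i) + 1, 3 * (3 ^ k * c i) + 2}"
    by (auto simp: field_simps)
  moreover have "3 * (3 ^ k * c i) \<in> \<int>"
    by (rule Ints_mult[OF Ints_numeral Suc.IH[OF c(1)]])
  ultimately show ?case
    by (metis Ints_1 Ints_add Ints_numeral empty_iff insert_iff)
qed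

text \<open>A cube of step \<open>k + 1\<close> containing \<open>x\<close> was kept because it
  meets the \<open>n\<close>-skeleton of a step-\<open>k\<close> cube in some \<open>y\<close>. All
  but \<open>n\<close> coordinates of \<open>y\<close> become integers after scaling by
  \<open>3 ^ k\<close>, and \<open>x\<close> differs from \<open>y\<close> by at most the side of
  the small cube, which scales to \<open>1/3\<close>.\<close>

lemma menger_set_near_grid:
  assumes "x \<in> menger_set n"
  obtains F where "finite F" "card F \<le> n"
    "\<And>i. i < 2 * n + 1 \<Longrightarrow> i \<notin> F \<Longrightarrow> \<exists>l::int. \<bar>3 ^ k * x i - l\<bar> \<le> 1/3"
proof -
  let ?d = "2 * n + 1" and ?s = "1 / 3 ^ k :: real"
  obtain b where b: "b \<in> menger_corners n (Suc k)" "x \<in> cube ?d b (1 / 3 ^ Suc k)"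
    using assms unfolding menger_set_def by blast
  then obtain a y where a: "a \<in> menger_corners n k" and y: "y \<in> cube ?d b (1 / 3 ^ Suc k)"
    "y \<in> cube_skeleton n ?d a ?s"
    by auto
  then obtain F where F: "F \<subseteq> {..<?d}" "card F = n"
    "\<And>i. i \<in> {..<?d} - F \<Longrightarrow> y i = a i \<or> y i = a i + ?s"
    unfolding cube_skeleton_def by blast
  show ?thesis
  proof (rule that[of F])
    show "finite F"
      using F(1) finite_subset by blast
    show "card F \<le> n"
      using F(2) by simp
    fix i assume i: "i < ?d" "i \<notin> F"
    obtain l :: int where l: "3 ^ k * a i = l"
      using menger_corners_grid[OF a i(1)] by (auto elim: Ints_cases)
    have "3 ^ k * y i = l \<or> 3 ^ k * y i = l + 1"
      using F(3)[of i] i l by (auto simp: algebra_simps)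
    then obtain l' :: int where l': "3 ^ k * y i = l'"
      by (metis of_int_1 of_int_add)
    have "\<bar>x i - y i\<bar> \<le> 1 / 3 ^ Suc k"
      using b(2) y(1) i by (auto simp: cube_def abs_le_iff dest!: spec[of _ i])
    then have "3 ^ k * \<bar>x i - y i\<bar> \<le> 3 ^ k * (1 / 3 ^ Suc k)"
      by (intro mult_left_mono) auto
    then have "\<bar>3 ^ k * x i - 3 ^ k * y i\<bar> \<le> 1/3"
      by (simp add: abs_mult flip: right_diff_distrib)
    then show "\<exists>l::int. \<bar>3 ^ k * x i - l\<bar> \<le> 1/3"
      using l' by metis
  qed
qed

section \<open>Compactness and the metric of the Menger set\<close>

lemma compact_cube: "compact (cube d a s)"
proof -
  \<comment> \<open>Coordinates from \<open>d\<close> on are frozen at \<open>0\<close>, so the cube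
    is a product of compact sets over all indices.\<close>
  have "cube d a s = (\<Pi>\<^sub>E i\<in>UNIV. if i < d then {a i..a i + s} else {0})"
    by (auto simp: cube_def topspace_Euclidean_space PiE_iff split: if_splits)
  moreover have "compactin (powertop_real UNIV) \<dots>"
    by (subst compactin_PiE) auto
  ultimately show ?thesis
    by (simp add: euclidean_product_topology)
qed

lemma finite_subcube_corners: "finite (subcube_corners d a s)"
proof (rule finite_subset)
  let ?A = "\<lambda>i. {a i, a i + s / 3, a i + 2 * s / 3}"
  show "subcube_corners d a s \<subseteq> (\<lambda>f i. if i < d then f i else 0) ` (\<Pi>\<^sub>E i\<in>{..<d}. ?A i)"
  proof
    fix b assume "b \<in> subcube_corners d a s"
    then show "b \<in> (\<lambda>f i. if i < d then f i else 0) ` (\<Pi>\<^sub>E i\<in>{..<d}. ?A i)"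
      by (intro image_eqI[where x = "restrict b {..<d}"])
         (auto simp: subcube_corners_def topspace_Euclidean_space fun_eq_iff)
  qed
  show "finite ((\<lambda>f i. if i < d then f i else 0) ` (\<Pi>\<^sub>E i\<in>{..<d}. ?A i))"
    by (intro finite_imageI finite_PiE) auto
qed

lemma finite_menger_corners: "finite (menger_corners n k)"
  by (induction k) (auto intro: finite_subset[OF _ finite_subcube_corners])

lemma compact_menger_set: "compact (menger_set n)"
proof -
  let ?M = "\<lambda>k. \<Union>a\<in>menger_corners n k. cube (2 * n + 1) a (1 / 3 ^ k)"
  have comp: "compact (?M k)" for k
    by (intro compact_UN finite_menger_corners compact_cube)
  then have "closed (\<Inter>k. ?M k)"
    by (intro closed_INT ballI compact_imp_closed)
  with comp[of 0] have "compact (?M 0 \<inter> (\<Inter>k. ?M k))"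
    by (rule compact_Int_closed)
  then show ?thesis
    unfolding menger_set_def by (rule back_subst[of compact]) blast
qed

lemma menger_set_subset: "menger_set n \<subseteq> topspace (Euclidean_space (2 * n + 1))"
  unfolding menger_set_def by (auto simp: cube_def)

text \<open>The topology of \<open>Euclidean_space\<close> is that of the product type
  \<open>nat \<Rightarrow> real\<close>, so metric arguments become available.\<close>

lemma menger_compactum_eq: "menger_compactum n = top_of_set (menger_set n)"
  using menger_set_subset
  by (simp add: menger_compactum_def Euclidean_space_def subtopology_subtopology
      topspace_Euclidean_space euclidean_product_topology Int_absorb1)

text \<open>The metric on sequences weights coordinates by powers of \<open>1/2\<close>, whose sum
  is \<open>2\<close>; the tail \<open>(1/2) ^ N\<close> vanishes in the limit.\<close>

lemma dist_fun_le:
  fixes x y :: "nat \<Rightarrow> real"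
  assumes "\<And>i. dist (x i) (y i) \<le> e"
  shows "dist x y \<le> 2 * e"
proof (rule field_le_epsilon)
  fix r :: real assume "r > 0"
  then obtain N where N: "(1/2) ^ N < r"
    using real_arch_pow_inv[of r "1/2"] by auto
  have "dist x y \<le> 2 * Max {dist (x (from_nat i)) (y (from_nat i)) |i. i \<le> N} + (1/2) ^ N"
    by (rule dist_fun_le_dist_first_terms)
  moreover have "Max {dist (x (from_nat i)) (y (from_nat i)) |i. i \<le> N} \<le> e"
    using assms by (subst Max_le_iff) auto
  ultimately show "dist x y \<le> 2 * e + r"
    using N by linarith
qed

theorem covering_dim_le_menger_slab:
  "covering_dim_le (prod_topology (menger_compactum n) (top_of_set {a..b::real})) (n + 1)"
proof -
  let ?d = "2 * n + 1"
  define S where "S = menger_set n \<times> {a..b}"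
  have comp: "compact S"
    unfolding S_def by (intro compact_Times compact_menger_set) auto
  have top: "prod_topology (menger_compactum n) (top_of_set {a..b}) = top_of_set S"
    by (simp add: menger_compactum_eq S_def)
  \<comment> \<open>The interval parameter is appended as coordinate \<open>?d\<close>, which is why
    cells use the indices \<open>i \<le> d\<close>.\<close>
  define y where "y p = (\<lambda>i. if i < ?d then fst p i else snd p)" for p :: "(nat \<Rightarrow> real) \<times> real"
  have dist: "dist p p' \<le> 3 * e"
    if "p \<in> S" "p' \<in> S" "\<And>i. i \<le> ?d \<Longrightarrow> \<bar>y p i - y p' i\<bar> \<le> e" for p p' e
  proof -
    have "e \<ge> 0"
      using that(3)[of 0] by simp
    have "dist (fst p i) (fst p' i) \<le> e" for i
    proof (cases "i < ?d")
      case True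
      then show ?thesis
        using that(3)[of i] by (simp add: y_def dist_real_def)
    next
      case False
      then have "fst p i = 0" "fst p' i = 0"
        using that(1,2) menger_set_subset[of n] by (auto simp: S_def topspace_Euclidean_space)
      then show ?thesis
        using \<open>e \<ge> 0\<close> by simp
    qed
    then have "dist (fst p) (fst p') \<le> 2 * e"
      by (rule dist_fun_le)
    moreover have "dist (snd p) (snd p') \<le> e"
      using that(3)[of ?d] by (simp add: y_def dist_real_def)
    moreover have "dist p p' \<le> dist (fst p) (fst p') + dist (snd p) (snd p')"
      unfolding dist_prod_def by (rule sqrt_sum_squares_le_sum) auto
    ultimately show ?thesis
      by linarith
  qed
  show ?thesis
    unfolding top covering_dim_le_def
  proof (intro allI impI)
    fix \<U> assume \<U>: "finite_open_cover (top_of_set S) \<U>"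
    define \<G> where "\<G> = {W. open W \<and> S \<inter> W \<in> \<U>}"
    have "S \<subseteq> \<Union>\<G>"
    proof
      fix p assume "p \<in> S"
      then obtain U where U: "U \<in> \<U>" "p \<in> U"
        using \<U> by (auto simp: finite_open_cover_def)
      then obtain W where "open W" "U = S \<inter> W"
        using \<U> by (auto simp: finite_open_cover_def openin_open)
      then show "p \<in> \<Union>\<G>"
        using U by (auto simp: \<G>_def)
    qed
    \<comment> \<open>A Lebesgue number for the cover.\<close>
    then obtain e where e: "e > 0" "\<And>p. p \<in> S \<Longrightarrow> \<exists>W\<in>\<G>. ball p e \<subseteq> W"
    proof (rule Heine_Borel_lemma[OF comp])
      show "open W" if "W \<in> \<G>" for W
        using that by (simp add: \<G>_def)
    qed blast
    \<comment> \<open>Undoing the scaling by \<open>3 ^ k\<close>, points of one cell differ by less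
      than \<open>(1/3) ^ k\<close> in each coordinate, hence by at most three times that in
      distance, which must stay below \<open>e\<close>.\<close>
    obtain k where k: "(1/3) ^ k < e / 3"
      using real_arch_pow_inv[of "e/3" "1/3"] e(1) by auto
    define C where "C j F z = {p \<in> S. (\<lambda>i. 3 ^ k * y p i) \<in> cell ?d j F z}" for j F z
    have C_open: "openin (top_of_set S) (C j F z)" for j F z
    proof -
      have y_cont: "continuous_on S (\<lambda>p. y p i)" for i
      proof (cases "i < ?d")
        case True
        have "continuous_on S (\<lambda>p. fst p i)"
          by (rule continuous_on_product_then_coordinatewise[OF continuous_on_fst[OF continuous_on_id]])
        then show ?thesis
          using True by (simp add: y_def)
      next
        case False
        then show ?thesis
          by (simp add: y_def continuous_on_snd[OF continuous_on_id])
      qed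
      let ?O = "\<lambda>i. if i \<in> F then {z i + level j <..< real_of_int (z i) + 1 - level j}
          else {z i - level j <..< z i + level j}"
      have "openin (top_of_set S) (S \<inter> (\<lambda>p. 3 ^ k * y p i) -` ?O i)" for i
        by (intro continuous_openin_preimage_gen continuous_on_mult_left y_cont) auto
      then have "openin (top_of_set S) (\<Inter>i\<in>{..?d}. S \<inter> (\<lambda>p. 3 ^ k * y p i) -` ?O i)"
        by (rule openin_INT2[rotated 2]) simp_all
      then show ?thesis
        by (rule back_subst[of "openin _"])
           (auto simp: C_def cell_def abs_less_iff split: if_splits)
    qed
    have C_small: "\<exists>U\<in>\<U>. C j F z \<subseteq> U" if ne: "C j F z \<noteq> {}" for j F z
    proof -
      obtain p where p: "p \<in> C j F z"
        using ne by blast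
      then obtain W where W: "W \<in> \<G>" "ball p e \<subseteq> W"
        using e(2)[of p] by (auto simp: C_def)
      have "C j F z \<subseteq> ball p e"
      proof
        fix p' assume p': "p' \<in> C j F z"
        have "\<bar>y p i - y p' i\<bar> \<le> (1/3) ^ k" if "i \<le> ?d" for i
        proof -
          have "\<bar>3 ^ k * y p i - 3 ^ k * y p' i\<bar> < 1"
            using cell_diameter[OF _ _ that, of "\<lambda>i. 3 ^ k * y p i" j F z "\<lambda>i. 3 ^ k * y p' i"] p p'
            by (simp add: C_def)
          then have "3 ^ k * \<bar>y p i - y p' i\<bar> < 1"
            by (simp add: abs_mult flip: right_diff_distrib)
          then show ?thesis
            by (simp add: field_simps)
        qed
        then have "dist p p' \<le> 3 * (1/3) ^ k"
          using p p' by (intro dist) (auto simp: C_def)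
        then show "p' \<in> ball p e"
          using k by simp
      qed
      then have "C j F z \<subseteq> S \<inter> W"
        using W by (auto simp: C_def)
      moreover have "S \<inter> W \<in> \<U>"
        using W by (simp add: \<G>_def)
      ultimately show ?thesis
        by blast
    qed
    have C_cov: "\<exists>j F z. j \<le> n + 1 \<and> p \<in> C j F z" if "p \<in> S" for p
    proof -
      have "fst p \<in> menger_set n"
        using that by (auto simp: S_def)
      then obtain F where F: "finite F" "card F \<le> n"
        "\<And>i. i < ?d \<Longrightarrow> i \<notin> F \<Longrightarrow> \<exists>l::int. \<bar>3 ^ k * fst p i - l\<bar> \<le> 1/3"
        using menger_set_near_grid[where k = k] by blast
      \<comment> \<open>The interval coordinate may be anywhere, so it joins the exceptional set and
        raises its size to \<open>n + 1\<close>.\<close>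
      have "\<exists>l::int. \<bar>3 ^ k * y p i - l\<bar> \<le> 1/3" if "i \<le> ?d" "i \<notin> insert ?d F" for i
        using F(3)[of i] that by (auto simp: y_def)
      moreover have "card (insert ?d F) \<le> n + 1"
        using F(1,2) by (simp add: card_insert_if)
      ultimately obtain j F' z where "j \<le> n + 1" "(\<lambda>i. 3 ^ k * y p i) \<in> cell ?d j F' z"
        using cell_cover[of "insert ?d F" "n + 1" ?d "\<lambda>i. 3 ^ k * y p i"] F(1) by blast
      then show ?thesis
        using \<open>p \<in> S\<close> by (auto simp: C_def)
    qed
    \<comment> \<open>Smallness was derived from a point of the cell, hence the restriction to
      nonempty ones. Compactness then selects finitely many.\<close>
    define \<C> where "\<C> = {C j F z |j F z. j \<le> n + 1 \<and> C j F z \<noteq> {}}"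
    have "S \<subseteq> \<Union>\<C>"
      using C_cov by (fastforce simp: \<C>_def)
    moreover have "\<forall>V\<in>\<C>. openin (top_of_set S) V"
      using C_open by (auto simp: \<C>_def)
    ultimately obtain \<V> where \<V>: "\<V> \<subseteq> \<C>" "finite \<V>" "S \<subseteq> \<Union>\<V>"
      using comp unfolding compact_eq_openin_cover by (metis (no_types, lifting))
    have "card {V \<in> \<V>. p \<in> V} \<le> n + 1 + 1" for p
    proof -
      have "\<exists>j. j \<le> n + 1 \<and> (\<exists>F z. V = C j F z)" if "V \<in> \<C>" for V
        using that unfolding \<C>_def by blast
      then obtain f where f: "\<And>V. V \<in> \<C> \<Longrightarrow> f V \<le> n + 1 \<and> (\<exists>F z. V = C (f V) F z)"
        by metis
      \<comment> \<open>Cells of one family that share \<open>p\<close> coincide, so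
        \<open>p\<close> lies in at most one per family, and the families \<open>0\<close> to
        \<open>n + 1\<close> number \<open>n + 2\<close>.\<close>
      have "inj_on f {V \<in> \<V>. p \<in> V}"
      proof (rule inj_onI; clarify)
        fix V V' assume V: "V \<in> \<V>" "p \<in> V" "V' \<in> \<V>" "p \<in> V'" "f V = f V'"
        define j where "j = f V"
        obtain F z F' z' where eq: "V = C j F z" "V' = C j F' z'"
          using f V \<V>(1) unfolding j_def by (metis subsetD)
        then have "cell ?d j F z = cell ?d j F' z'"
          using V(2,4) by (intro cell_eq_of_common_point[of "\<lambda>i. 3 ^ k * y p i"]) (auto simp: C_def)
        then show "V = V'"
          unfolding eq by (simp add: C_def)
      qed
      moreover have "f ` {V \<in> \<V>. p \<in> V} \<subseteq> {..n + 1}"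
        using f \<V>(1) by auto
      ultimately have "card {V \<in> \<V>. p \<in> V} \<le> card {..n + 1}"
        by (intro card_inj_on_le) auto
      then show ?thesis
        by simp
    qed
    moreover have "finite_open_cover (top_of_set S) \<V>"
      using \<V> C_open by (auto simp: finite_open_cover_def \<C>_def C_def)
    moreover have "\<forall>V\<in>\<V>. \<exists>U\<in>\<U>. V \<subseteq> U"
    proof
      fix V assume "V \<in> \<V>"
      then obtain j F z where "V = C j F z" "C j F z \<noteq> {}"
        using \<V>(1) unfolding \<C>_def by blast
      then show "\<exists>U\<in>\<U>. V \<subseteq> U"
        using C_small by blast
    qed
    ultimately show "\<exists>\<V>. finite_open_cover (top_of_set S) \<V> \<and> (\<forall>V\<in>\<V>. \<exists>U\<in>\<U>. V \<subseteq> U) \<and>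
        (\<forall>p\<in>topspace (top_of_set S). card {V \<in> \<V>. p \<in> V} \<le> n + 1 + 1)"
      by blast
  qed
qed


theorem corollary2p18:
  fixes n m :: nat
    and G :: "('g, 'b) monoid_scheme"
    and T :: "'g topology"
    and act :: "(nat \<Rightarrow> real) \<Rightarrow> 'g \<Rightarrow> (nat \<Rightarrow> real)"
  assumes "n < m"
    and "compact_topological_group G T"
    and "free_continuous_right_action G T (menger_compactum n) act"
    and "covering_dim_le (orbit_space G (menger_compactum n) act) m"
  shows "covering_dim_le
           (orbit_space G (join_space (menger_compactum n) T)
              (diagonal_act G T (menger_compactum n) act)) m"
proof -
  interpret free_continuous_right_action G T "menger_compactum n" act
    by (rule assms(3))
  have "compact_space (menger_compactum n)"
    using compact_menger_set[of n] by (simp add: menger_compactum_eq compact_space_subtopology)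
  \<comment> \<open>Here \<open>n < m\<close> enters: the slab bound \<open>n + 1\<close> is at most
    \<open>m\<close>.\<close>
  moreover have "covering_dim_le (prod_topology (menger_compactum n) (top_of_set {a..b::real})) m" for a b
    by (rule covering_dim_le_mono[OF covering_dim_le_menger_slab]) (use assms(1) in simp)
  ultimately show ?thesis
    using assms(4) by (intro covering_dim_le_orbit_space_join)
qed

end
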